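(* Let $\succeq_1,\ldots,\succeq_n,\succeq$ be monotone stationary time preferences, where each $\succeq_i$ is represented by $u_i(x)e^{-r_i\Phi_i(T)}$ and $\succeq$ is represented by $u(x)e^{-r\Phi(T)}$, for some monotone additive statistics $\Phi_1,\dots,\Phi_n,\Phi$, constants $r_1,\dots,r_n,r>0$, and continuous, strictly increasing functions $u_1,\dots,u_n,u\colon\mathbb{R}_{++}\to\mathbb{R}_{++}$. If there exist $\lambda_1,\ldots,\lambda_n\in\mathbb{R}_+$ such that $$r=\sum_{i=1}^n\lambda_ir_i,\qquad r\Phi=\sum_{i=1}^n\lambda_ir_i\Phi_i,\qquad u=\prod_{i=1}^nu_i^{\lambda_i},$$ then the Pareto axiom is satisfied.
   Context: $L^\infty_+$ is the set of non-negative bounded random variables on a fixed nonatomic probability space. $\mathbb{R}_{++}=(0,\infty)$, $\mathbb{R}_+=[0,\infty)$. A time lottery is a pair $(x,T)\in\mathbb{R}_{++}\times L^\infty_+$. A monotone additive statistic on $L^\infty_+$ is a map $\Phi\colon L^\infty_+\to\mathbb{R}$ that depends only on the distribution, satisfies $\Phi(c)=c$ for constants $c\ge0$, is additive for sums of independent random variables, and is monotone with respect to first-order stochastic dominance. A preference is represented by $V$ if $(x,T)\succeq(y,S)$ if and only if $V(x,T)\ge V(y,S)$. A monotone stationary time preference (MSTP) is a preference over time lotteries that is represented by $u(x)e^{-r\Phi(T)}$ for some monotone additive statistic $\Phi$, some $r>0$ and some continuous strictly increasing $u\colon\mathbb{R}_{++}\to\mathbb{R}_{++}$ (this is equivalent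 to its axiomatic definition). Pareto axiom: for all time lotteries, if $(x,T)\succeq_i(y,S)$ for every $i=1,\ldots,n$, then $(x,T)\succeq(y,S)$. *)

theory Defs
  imports "HOL-Probability.Probability"
begin

locale nonatomic_prob_space = prob_space +
  assumes nonatomic:
    "A \<in> sets M \<Longrightarrow> 0 < measure M A \<Longrightarrow>
      \<exists>B\<in>sets M. B \<subseteq> A \<and> 0 < measure M B \<and> measure M B < measure M A"

text \<open>
  Elements of \<open>L\<^sup>\<infinity>\<^sub>+\<close> are given by representatives: measurable functions that are almost surely
  non-negative and essentially bounded. Statistics on this set are required below to depend
  only on the distribution, so they do not distinguish representatives of the same class.
\<close>

definition Linf_plus :: "'a measure \<Rightarrow> ('a \<Rightarrow> real) set" where
  "Linf_plus M =
    {X \<in> borel_measurable M. (AE \<omega> in M. 0 \<le> X \<omega>) \<and> (\<exists>C. AE \<omega> in M. X \<omega> \<le> C)}"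

type_synonym 'a lottery = "real \<times> ('a \<Rightarrow> real)"

definition time_lotteries :: "'a measure \<Rightarrow> 'a lottery set" where
  "time_lotteries M = {0<..} \<times> Linf_plus M"

definition fosd :: "'a measure \<Rightarrow> ('a \<Rightarrow> real) \<Rightarrow> ('a \<Rightarrow> real) \<Rightarrow> bool" where
  "fosd M X Y \<longleftrightarrow> (\<forall>a. cdf (distr M borel X) a \<le> cdf (distr M borel Y) a)"

text \<open>Only the values of \<open>\<Phi>\<close> on \<open>L\<^sup>\<infinity>\<^sub>+\<close> are meaningful.\<close>

definition monotone_additive_statistic ::
    "'a measure \<Rightarrow> (('a \<Rightarrow> real) \<Rightarrow> real) \<Rightarrow> bool" where
  "monotone_additive_statistic M \<Phi> \<longleftrightarrow>
    (\<forall>X\<in>Linf_plus M. \<forall>Y\<in>Linf_plus M. distr M borel X = distr M borel Y \<longrightarrow> \<Phi> X = \<Phi> Y) \<and>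
    (\<forall>c\<ge>0. \<Phi> (\<lambda>_. c) = c) \<and>
    (\<forall>X\<in>Linf_plus M. \<forall>Y\<in>Linf_plus M. prob_space.indep_var M borel X borel Y \<longrightarrow>
      \<Phi> (\<lambda>\<omega>. X \<omega> + Y \<omega>) = \<Phi> X + \<Phi> Y) \<and>
    (\<forall>X\<in>Linf_plus M. \<forall>Y\<in>Linf_plus M. fosd M X Y \<longrightarrow> \<Phi> X \<ge> \<Phi> Y)"

definition utility_function :: "(real \<Rightarrow> real) \<Rightarrow> bool" where
  "utility_function u \<longleftrightarrow>
    u ` {0<..} \<subseteq> {0<..} \<and> continuous_on {0<..} u \<and> strict_mono_on {0<..} u"

definition mstp_value ::
    "(real \<Rightarrow> real) \<Rightarrow> real \<Rightarrow> (('a \<Rightarrow> real) \<Rightarrow> real) \<Rightarrow> 'a lottery \<Rightarrow> real" where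
  "mstp_value u r \<Phi> = (\<lambda>(x, T). u x * exp (- r * \<Phi> T))"

text \<open>\<open>R p q\<close> reads ``\<open>p\<close> is weakly preferred to \<open>q\<close>''; only its restriction to time lotteries matters.\<close>

definition represented_by ::
    "'a measure \<Rightarrow> ('a lottery \<Rightarrow> 'a lottery \<Rightarrow> bool) \<Rightarrow> ('a lottery \<Rightarrow> real) \<Rightarrow> bool" where
  "represented_by M R V \<longleftrightarrow>
    (\<forall>p\<in>time_lotteries M. \<forall>q\<in>time_lotteries M. R p q \<longleftrightarrow> V p \<ge> V q)"

definition mstp :: "'a measure \<Rightarrow> ('a lottery \<Rightarrow> 'a lottery \<Rightarrow> bool) \<Rightarrow> bool" where
  "mstp M R \<longleftrightarrow>
    (\<exists>\<Phi> r u. monotone_additive_statistic M \<Phi> \<and> 0 < r \<and> utility_function u \<and>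
      represented_by M R (mstp_value u r \<Phi>))"

definition pareto ::
    "'a measure \<Rightarrow> nat \<Rightarrow> (nat \<Rightarrow> 'a lottery \<Rightarrow> 'a lottery \<Rightarrow> bool) \<Rightarrow>
      ('a lottery \<Rightarrow> 'a lottery \<Rightarrow> bool) \<Rightarrow> bool" where
  "pareto M n R R0 \<longleftrightarrow>
    (\<forall>p\<in>time_lotteries M. \<forall>q\<in>time_lotteries M. (\<forall>i\<in>{1..n}. R i p q) \<longrightarrow> R0 p q)"

end

theory Submission
  imports Defs
begin

text \<open>The three relations between the parameters say that the social value is a weighted
  geometric mean in form: writing V_i for the value of agent i, V(x,T) is the product of the
  V_i(x,T)^(\<mu>_i), because exp turns the weighted sum of the r_i \<Phi>_i into a product of
  powers (\<open>mstp_value_eq_prod_powr\<close>). Values are positive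
  (\<open>mstp_value_pos\<close>), and t^\<mu> is nondecreasing in t \<ge> 0 when \<mu> \<ge> 0. So
  if every V_i ranks p at least as high as q, each factor at p is at least the factor at q, and so
  is the product.\<close>

lemma mstp_value_pos:
  assumes "utility_function u" "p \<in> time_lotteries M"
  shows "0 < mstp_value u r \<Phi> p"
  using assms by (auto simp: utility_function_def time_lotteries_def mstp_value_def)

text \<open>The utility part and the discount part factor over the agents separately, and the two
  products combine agent by agent. The weights may have any sign here; their sign matters only for
  monotonicity.\<close>

lemma mstp_value_eq_prod_powr:
  assumes p: "p \<in> time_lotteries M"
    and u: "\<And>i. i \<in> I \<Longrightarrow> utility_function (u i)"
    and u0: "\<And>x. 0 < x \<Longrightarrow> u0 x = (\<Prod>i\<in>I. u i x powr \<mu> i)"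
    and \<Phi>0: "\<And>T. T \<in> Linf_plus M \<Longrightarrow> r0 * \<Phi>0 T = (\<Sum>i\<in>I. \<mu> i * r i * \<Phi> i T)"
    and fin: "finite I"
  shows "mstp_value u0 r0 \<Phi>0 p = (\<Prod>i\<in>I. mstp_value (u i) (r i) (\<Phi> i) p powr \<mu> i)"
proof -
  obtain x T where p_eq: "p = (x, T)" and x: "0 < x" and T: "T \<in> Linf_plus M"
    using p by (auto simp: time_lotteries_def)
  \<comment> \<open>Each base is an exponential, so ln cancels it in the definition of
    \<open>powr\<close>, and the power is exp of -\<mu>_i r_i \<Phi>_i(T).\<close>
  have "exp (- r0 * \<Phi>0 T) = (\<Prod>i\<in>I. exp (- r i * \<Phi> i T) powr \<mu> i)"
    using \<Phi>0[OF T] fin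
    by (simp add: exp_sum powr_def mult_ac flip: sum_negf)
  \<comment> \<open>Positivity of the utility lets \<open>powr\<close> distribute over the product
    of utility and discount factor.\<close>
  moreover have "0 < u i x" if "i \<in> I" for i
    using u[OF that] x by (auto simp: utility_function_def)
  ultimately show ?thesis
    using u0[OF x] by (simp add: p_eq mstp_value_def powr_mult less_imp_le prod.distrib)
qed

theorem proposition3:
  fixes M :: "'a measure" and n :: nat
    and R :: "nat \<Rightarrow> 'a lottery \<Rightarrow> 'a lottery \<Rightarrow> bool"
    and R0 :: "'a lottery \<Rightarrow> 'a lottery \<Rightarrow> bool"
    and \<Phi> :: "nat \<Rightarrow> ('a \<Rightarrow> real) \<Rightarrow> real" and \<Phi>0 :: "('a \<Rightarrow> real) \<Rightarrow> real"
    and r :: "nat \<Rightarrow> real" and r0 :: real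
    and u :: "nat \<Rightarrow> real \<Rightarrow> real" and u0 :: "real \<Rightarrow> real"
  assumes "nonatomic_prob_space M"
    and "\<And>i. i \<in> {1..n} \<Longrightarrow> mstp M (R i)"
    and "mstp M R0"
    and "\<And>i. i \<in> {1..n} \<Longrightarrow> monotone_additive_statistic M (\<Phi> i)"
    and "monotone_additive_statistic M \<Phi>0"
    and "\<And>i. i \<in> {1..n} \<Longrightarrow> 0 < r i"
    and "0 < r0"
    and "\<And>i. i \<in> {1..n} \<Longrightarrow> utility_function (u i)"
    and "utility_function u0"
    and "\<And>i. i \<in> {1..n} \<Longrightarrow> represented_by M (R i) (mstp_value (u i) (r i) (\<Phi> i))"
    and "represented_by M R0 (mstp_value u0 r0 \<Phi>0)"
    and "\<exists>\<mu> :: nat \<Rightarrow> real.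
      (\<forall>i\<in>{1..n}. 0 \<le> \<mu> i) \<and>
      r0 = (\<Sum>i=1..n. \<mu> i * r i) \<and>
      (\<forall>T\<in>Linf_plus M. r0 * \<Phi>0 T = (\<Sum>i=1..n. \<mu> i * r i * \<Phi> i T)) \<and>
      (\<forall>x>0. u0 x = (\<Prod>i=1..n. u i x powr \<mu> i))"
  shows "pareto M n R R0"
proof -
  obtain \<mu> :: "nat \<Rightarrow> real" where \<mu>: "\<And>i. i \<in> {1..n} \<Longrightarrow> 0 \<le> \<mu> i"
    and \<Phi>0: "\<And>T. T \<in> Linf_plus M \<Longrightarrow> r0 * \<Phi>0 T = (\<Sum>i=1..n. \<mu> i * r i * \<Phi> i T)"
    and u0: "\<And>x. 0 < x \<Longrightarrow> u0 x = (\<Prod>i=1..n. u i x powr \<mu> i)"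
    using assms(12) by blast
  let ?V = "\<lambda>i. mstp_value (u i) (r i) (\<Phi> i)"
  have V0: "mstp_value u0 r0 \<Phi>0 p = (\<Prod>i=1..n. ?V i p powr \<mu> i)"
    if "p \<in> time_lotteries M" for p
    using that assms(8) u0 \<Phi>0 by (intro mstp_value_eq_prod_powr) auto
  show ?thesis
    unfolding pareto_def
  proof (intro ballI impI)
    fix p q assume p: "p \<in> time_lotteries M" and q: "q \<in> time_lotteries M"
      and unanimous: "\<forall>i\<in>{1..n}. R i p q"
    \<comment> \<open>Unanimity is used one agent at a time; the nonnegative weight keeps the
      direction of the inequality.\<close>
    have "?V i q powr \<mu> i \<le> ?V i p powr \<mu> i" if i: "i \<in> {1..n}" for i
    proof (rule powr_mono2)
      show "0 \<le> \<mu> i" using \<mu>[OF i] .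
      show "0 \<le> ?V i q" using mstp_value_pos[OF assms(8)[OF i] q] by (rule less_imp_le)
      show "?V i q \<le> ?V i p"
        using assms(10)[OF i] unanimous i p q unfolding represented_by_def by blast
    qed
    \<comment> \<open>The factorwise inequalities multiply because the factors at q, being values of
      \<open>powr\<close>, are nonnegative.\<close>
    then have "mstp_value u0 r0 \<Phi>0 q \<le> mstp_value u0 r0 \<Phi>0 p"
      unfolding V0[OF p] V0[OF q] by (intro prod_mono) auto
    then show "R0 p q"
      using assms(11) p q by (auto simp: represented_by_def)
  qed
qed

end
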